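(* Let $V$ be a vector space of dimension $\ell$ over a field $K$, and let $\Delta=(\alpha_1,\dots,\alpha_n)$ be a sequence of elements of $V^*$ spanning $V^*$. Let $E=\{1,\dots,n\}$, let $M(\Delta)$ be the matroid on $E$ with rank function $r(S)=\dim\operatorname{span}\{\alpha_i:i\in S\}$, and let $P(\Delta)$ be the $K$-subspace of $\operatorname{Sym}(V^* )$ spanned by all products $\alpha_S=\prod_{i\in S}\alpha_i$, $S\subseteq E$. Then for an integer $d\ge 0$, the containment $\operatorname{Sym}^d(V^* )\subseteq P(\Delta)$ holds if and only if $d$ is less than or equal to the size of the smallest cocircuit of $M(\Delta)$.
   Context: The cocircuits of $M(\Delta)$ are the sets $E-H$ where $H$ is a flat of $M(\Delta)$ with $r(H)=\ell-1$; a flat is a set $X\subseteq E$ with $r(X)<r(Y)$ for every strict superset $Y\supsetneq X$. $\operatorname{Sym}^d(V^* )$ is the space of homogeneous polynomial functions of degree $d$ on $V$. *)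

theory Defs
  imports
    Complex_Main
    "HOL-Library.Poly_Mapping"
    "HOL-Library.Function_Algebras"
    "HOL-Library.Extended_Nat"
begin

global_interpretation fun_vs: vector_space "\<lambda>(c::'k::field) (f::'v \<Rightarrow> 'k) x. c * f x"
  defines fun_span = fun_vs.span
    and fun_dim = fun_vs.dim
  by unfold_locales (auto simp: fun_eq_iff algebra_simps)

definition dual_space :: "('k::field \<Rightarrow> 'v::ab_group_add \<Rightarrow> 'v) \<Rightarrow> ('v \<Rightarrow> 'k) set" where
  "dual_space scale = {f. Vector_Spaces.linear scale (*) f}"

definition vrank :: "(nat \<Rightarrow> 'v \<Rightarrow> 'k::field) \<Rightarrow> nat set \<Rightarrow> nat" where
  "vrank \<alpha> S = fun_dim (fun_span (\<alpha> ` S))"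

definition flat :: "'e set \<Rightarrow> ('e set \<Rightarrow> nat) \<Rightarrow> 'e set \<Rightarrow> bool" where
  "flat E r X \<longleftrightarrow> X \<subseteq> E \<and> (\<forall>Y. X \<subset> Y \<and> Y \<subseteq> E \<longrightarrow> r X < r Y)"

text \<open>The rank condition \<open>r H = l - 1\<close> is written \<open>r H + 1 = l\<close>: for \<open>l = 0\<close> truncated
  subtraction would turn \<open>E\<close> itself into a hyperplane, whereas there are no cocircuits.\<close>

definition cocircuits :: "'e set \<Rightarrow> ('e set \<Rightarrow> nat) \<Rightarrow> nat \<Rightarrow> 'e set set" where
  "cocircuits E r l = {E - H | H. flat E r H \<and> r H + 1 = l}"

text \<open>For a basis \<open>B\<close> of \<open>V\<close>, the symmetric algebra of \<open>V\<^sup>*\<close> is the polynomial ring over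
  \<open>K\<close> in the coordinates \<open>x\<^sub>b\<close> dual to \<open>b \<in> B\<close>. Variables are indexed by vectors; only those in
  \<open>B\<close> are used. Over a finite field distinct elements of the symmetric algebra can induce the same
  function on \<open>V\<close>, so its elements are formal polynomials, not functions.\<close>

type_synonym ('v, 'k) sympoly = "('v \<Rightarrow>\<^sub>0 nat) \<Rightarrow>\<^sub>0 'k"

global_interpretation sym_vs: vector_space
  "\<lambda>(c::'k::field) (p::('v, 'k) sympoly). Poly_Mapping.single 0 c * p"
  defines sym_span = sym_vs.span
  by unfold_locales
    (simp_all add: distrib_left distrib_right single_add mult_single mult.assoc[symmetric])

definition Sym :: "'v set \<Rightarrow> nat \<Rightarrow> ('v, 'k::field) sympoly set" where
  "Sym B d = {p. \<forall>m \<in> Poly_Mapping.keys p.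
     Poly_Mapping.keys m \<subseteq> B \<and> (\<Sum>b\<in>Poly_Mapping.keys m. Poly_Mapping.lookup m b) = d}"

text \<open>The inclusion of \<open>V\<^sup>*\<close> into its symmetric algebra: \<open>f = \<Sum>b\<in>B. f b \<cdot> x\<^sub>b\<close>.\<close>

definition sym_form :: "'v set \<Rightarrow> ('v \<Rightarrow> 'k::field) \<Rightarrow> ('v, 'k) sympoly" where
  "sym_form B f = (\<Sum>b\<in>B. Poly_Mapping.single (Poly_Mapping.single b 1) (f b))"

definition P_space :: "'v set \<Rightarrow> nat set \<Rightarrow> (nat \<Rightarrow> 'v \<Rightarrow> 'k::field) \<Rightarrow> ('v, 'k) sympoly set" where
  "P_space B E \<alpha> = sym_span {\<Prod>i\<in>S. sym_form B (\<alpha> i) | S. S \<subseteq> E}"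

end

(*
  Hyperplane flats of M(\<Delta>) are the maximal sets H for which some v \<noteq> 0 is a common zero of the
  forms indexed by H. So the smallest cocircuit has size at least d iff the distance condition holds:
  every v \<noteq> 0 has at least d indices i with \<alpha>\<^sub>i(v) \<noteq> 0.

  If the condition fails at v, then every product of d of the forms vanishes at v; hence the
  degree d part of P(\<Delta>) vanishes at v, whereas x\<^sub>b\<^sup>d does not for a coordinate x\<^sub>b with x\<^sub>b(v) \<noteq> 0.

  For the converse, contraction is replaced by restricting v to the common zeros of a set T of forms
  and enlarging P(\<Delta>) by the multiples of those forms. Removing an element a from S, write a
  polynomial of degree d as an element for (S, T \<union> {a}, d); the coefficient of \<alpha>\<^sub>a in it has degree
  d - 1 and is handled by (S, T, d - 1).
*)

theory Submission
  imports Defs "HOL-Computational_Algebra.Polynomial"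
begin

subsection \<open>Linear functionals\<close>

lemma sum_apply: "(\<Sum>a\<in>A. f a) x = (\<Sum>a\<in>A. f a x)"
  by (induction A rule: infinite_finite_induct) simp_all

lemma dual_spaceD:
  assumes "f \<in> dual_space scale"
  shows "f (x + y) = f x + f y" "f (x - y) = f x - f y" "f (scale c x) = c * f x" "f 0 = 0"
    "f (sum g A) = (\<Sum>a\<in>A. f (g a))"
proof -
  interpret Vector_Spaces.linear scale "(*)" f
    using assms by (simp add: dual_space_def)
  show "f (x + y) = f x + f y" "f (x - y) = f x - f y" "f (scale c x) = c * f x" "f 0 = 0"
    "f (sum g A) = (\<Sum>a\<in>A. f (g a))"
    by (rule add diff scale zero sum)+
qed

context vector_space
begin

lemma dual_spaceI:
  assumes "\<And>x y. f (x + y) = f x + f y" "\<And>c x. f (scale c x) = c * f x"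
  shows "f \<in> dual_space scale"
proof -
  have "Vector_Spaces.linear scale (*) f"
    using assms by unfold_locales (auto simp: algebra_simps)
  then show ?thesis by (simp add: dual_space_def)
qed

lemma subspace_dual_space: "fun_vs.subspace (dual_space scale)"
  by (rule fun_vs.subspaceI) (auto intro!: dual_spaceI simp: dual_spaceD algebra_simps)

text \<open>By induction on \<open>T\<close>: if \<open>\<alpha> a\<close> is nonzero at some
  \<open>v0\<close> in the common kernel of the other forms, then that kernel is spanned by
  \<open>v0\<close> and its vectors on which \<open>\<alpha> a\<close> vanishes, so subtracting from
  \<open>f\<close> a multiple of \<open>\<alpha> a\<close> that corrects the value at
  \<open>v0\<close> reduces to \<open>T\<close>.\<close>

lemma in_fun_span_if_vanishes_on_common_kernel:
  assumes "finite T" "\<forall>j\<in>T. \<alpha> j \<in> dual_space scale" "f \<in> dual_space scale"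
    and "\<And>v. \<forall>j\<in>T. \<alpha> j v = 0 \<Longrightarrow> f v = 0"
  shows "f \<in> fun_span (\<alpha> ` T)"
  using assms
proof (induction T arbitrary: f rule: finite_induct)
  case empty
  then have "f = 0" by (simp add: fun_eq_iff)
  then show ?case by (simp only: fun_vs.span_zero)
next
  case (insert a T)
  have a: "\<alpha> a \<in> dual_space scale" using insert.prems by simp
  show ?case
  proof (cases "\<exists>v. (\<forall>j\<in>T. \<alpha> j v = 0) \<and> \<alpha> a v \<noteq> 0")
    case True
    then obtain v0 where v0: "\<forall>j\<in>T. \<alpha> j v0 = 0" "\<alpha> a v0 \<noteq> 0" by blast
    define c where "c = f v0 / \<alpha> a v0"
    have "f - (\<lambda>x. c * \<alpha> a x) \<in> fun_span (\<alpha> ` T)"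
    proof (rule insert.IH)
      show "\<forall>j\<in>T. \<alpha> j \<in> dual_space scale" using insert.prems by simp
      show "f - (\<lambda>x. c * \<alpha> a x) \<in> dual_space scale"
        by (intro fun_vs.subspace_diff fun_vs.subspace_scale subspace_dual_space a insert.prems)
      fix v assume v: "\<forall>j\<in>T. \<alpha> j v = 0"
      \<comment> \<open>The projection of \<open>v\<close> along \<open>v0\<close> into the kernel
        of \<open>\<alpha> a\<close>. By the choice of \<open>c\<close>, the difference
        \<open>f - c * \<alpha> a\<close> vanishes at \<open>v0\<close>, so it takes the same value
        at \<open>v\<close> as at \<open>w\<close>.\<close>
      define w where "w = v - scale (\<alpha> a v / \<alpha> a v0) v0"
      have "\<forall>j\<in>insert a T. \<alpha> j w = 0"
        using v v0 insert.prems by (auto simp: w_def dual_spaceD)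
      then have "f w = 0" by (rule insert.prems)
      then show "(f - (\<lambda>x. c * \<alpha> a x)) v = 0"
        using insert.prems(2) by (simp add: w_def c_def dual_spaceD)
    qed
    then have "f - (\<lambda>x. c * \<alpha> a x) \<in> fun_span (\<alpha> ` insert a T)"
      using fun_vs.span_mono[of "\<alpha> ` T" "\<alpha> ` insert a T"] by blast
    moreover have "(\<lambda>x. c * \<alpha> a x) \<in> fun_span (\<alpha> ` insert a T)"
      by (intro fun_vs.span_scale fun_vs.span_base) simp
    ultimately show ?thesis
      using fun_vs.span_add by fastforce
  next
    case False
    \<comment> \<open>Here \<open>\<alpha> a\<close> vanishes wherever the forms in \<open>T\<close>
      do, so the kernel hypothesis on \<open>f\<close> already holds for \<open>T\<close>.\<close>
    then have "f \<in> fun_span (\<alpha> ` T)"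
      using insert.prems by (intro insert.IH) auto
    then show ?thesis
      using fun_vs.span_mono[of "\<alpha> ` T" "\<alpha> ` insert a T"] by blast
  qed
qed

end

section \<open>The dual basis and the rank of a family of functionals\<close>

context finite_dimensional_vector_space
begin

definition coord :: "'b \<Rightarrow> 'b \<Rightarrow> 'a" where
  "coord b v = representation Basis v b"

lemma coord_dual: "coord b \<in> dual_space scale"
  by (intro dual_spaceI)
    (simp_all add: coord_def representation_add representation_scale independent_Basis span_Basis)

lemma sum_representation: "(\<Sum>b\<in>Basis. scale (representation Basis v b) b) = v"
  by (rule sum_representation_eq) (auto simp: independent_Basis span_Basis finite_Basis)

lemma ex_representation_nonzero:
  assumes "v \<noteq> 0" shows "\<exists>b\<in>Basis. representation Basis v b \<noteq> 0"
proof (rule ccontr)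
  assume "\<not> ?thesis"
  then have "(\<Sum>b\<in>Basis. scale (representation Basis v b) b) = 0" by simp
  then show False using assms by (simp add: sum_representation)
qed

lemma representation_Basis_self:
  "b \<in> Basis \<Longrightarrow> representation Basis b b' = (if b' = b then 1 else 0)"
  using representation_basis[OF independent_Basis, of b] by auto

lemma dual_space_expand:
  assumes "f \<in> dual_space scale"
  shows "f v = (\<Sum>b\<in>Basis. representation Basis v b * f b)"
  by (subst sum_representation[of v, symmetric]) (simp only: dual_spaceD[OF assms])

text \<open>Evaluation at the basis vectors isolates the coefficients, giving independence; spanning
  holds because a vector with all coordinates zero is killed by every functional. The cardinality
  makes the dual space have the dimension of \<open>V\<close>.\<close>

lemma dual_basis:
  "fun_vs.independent (coord ` Basis)" "fun_span (coord ` Basis) = dual_space scale"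
  "card (coord ` Basis) = card Basis"
proof -
  have inj: "inj_on coord Basis"
  proof (rule inj_onI)
    fix b c assume "b \<in> Basis" "c \<in> Basis" "coord b = coord c"
    then have "representation Basis b b = representation Basis b c"
      by (simp add: coord_def fun_eq_iff)
    then show "b = c"
      using representation_Basis_self[OF \<open>b \<in> Basis\<close>] by (auto split: if_splits)
  qed
  then show "card (coord ` Basis) = card Basis" by (rule card_image)
  show "fun_vs.independent (coord ` Basis)"
  proof (rule fun_vs.independent_if_scalars_zero)
    fix u :: "('b \<Rightarrow> 'a) \<Rightarrow> 'a" and x
    assume *: "(\<Sum>x\<in>coord ` Basis. (\<lambda>v. u x * x v)) = 0" and "x \<in> coord ` Basis"
    then obtain b where b: "b \<in> Basis" "x = coord b" by blast
    have "0 = (\<Sum>x\<in>coord ` Basis. (\<lambda>v. u x * x v)) b" using * by simp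
    also have "\<dots> = (\<Sum>c\<in>Basis. u (coord c) * coord c b)"
      by (simp add: sum.reindex[OF inj] sum_apply)
    also have "\<dots> = (\<Sum>c\<in>Basis. if c = b then u (coord c) else 0)"
      by (intro sum.cong) (auto simp: coord_def representation_Basis_self b)
    finally show "u x = 0" using b finite_Basis by simp
  qed (simp add: finite_Basis)
  have *: "coord ` Basis \<subseteq> dual_space scale"
    using coord_dual by auto
  show "fun_span (coord ` Basis) = dual_space scale"
  proof
    show "fun_span (coord ` Basis) \<subseteq> dual_space scale"
      using * by (rule fun_vs.span_minimal) (rule subspace_dual_space)
    show "dual_space scale \<subseteq> fun_span (coord ` Basis)"
    proof
      fix f assume f: "f \<in> dual_space scale"
      show "f \<in> fun_span (coord ` Basis)"
      proof (rule in_fun_span_if_vanishes_on_common_kernel[OF finite_Basis _ f])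
        fix v assume "\<forall>j\<in>Basis. coord j v = 0"
        then show "f v = 0"
          by (subst dual_space_expand[OF f]) (simp add: coord_def)
      qed (use * in auto)
    qed
  qed
qed

lemma vrank_eq_dim_if_spanning:
  assumes "fun_span (\<alpha> ` H) = dual_space scale"
  shows "vrank \<alpha> H = dim UNIV"
  unfolding vrank_def assms
  by (metis dual_basis dim_UNIV fun_vs.dim_span_eq_card_independent)

text \<open>A functional outside the span could be added to a basis of it, giving an independent set
  larger than the dual basis.\<close>

lemma spanning_if_vrank_ge_dim:
  assumes "finite H" "\<alpha> ` H \<subseteq> dual_space scale" "dim UNIV \<le> vrank \<alpha> H"
  shows "fun_span (\<alpha> ` H) = dual_space scale"
proof
  show "fun_span (\<alpha> ` H) \<subseteq> dual_space scale"
    using assms(2) by (rule fun_vs.span_minimal) (rule subspace_dual_space)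
  show "dual_space scale \<subseteq> fun_span (\<alpha> ` H)"
  proof (rule ccontr)
    assume "\<not> ?thesis"
    then obtain f where f: "f \<in> dual_space scale" "f \<notin> fun_span (\<alpha> ` H)" by blast
    obtain C where C: "C \<subseteq> \<alpha> ` H" "fun_vs.independent C" "\<alpha> ` H \<subseteq> fun_span C"
      "card C = fun_dim (\<alpha> ` H)"
      by (rule fun_vs.basis_exists)
    have fC: "f \<notin> fun_span C" using f(2) C(1) fun_vs.span_mono by blast
    then have "f \<notin> C" by (auto intro: fun_vs.span_base)
    have "finite C" using C(1) assms(1) finite_surj by blast
    have "card (insert f C) \<le> card (coord ` Basis)"
      using fun_vs.independent_span_bound[of "coord ` Basis" "insert f C"]
        fun_vs.independent_insertI[OF fC C(2)] C(1) f(1) assms(2) finite_Basis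
      by (auto simp: dual_basis)
    then show False
      using \<open>f \<notin> C\<close> \<open>finite C\<close> assms(3) C(4) by (simp add: dual_basis vrank_def)
  qed
qed

lemma vrank_insert_le:
  assumes "finite H"
  shows "vrank \<alpha> (insert e H) \<le> vrank \<alpha> H + 1"
proof -
  obtain C where C: "C \<subseteq> \<alpha> ` H" "\<alpha> ` H \<subseteq> fun_span C" "card C = fun_dim (\<alpha> ` H)"
    by (rule fun_vs.basis_exists)
  have fin: "finite C" using C(1) assms finite_surj by blast
  have "\<alpha> ` insert e H \<subseteq> fun_span (insert (\<alpha> e) C)"
    using C(2) fun_vs.span_mono[of C "insert (\<alpha> e) C"] fun_vs.span_base[of "\<alpha> e" "insert (\<alpha> e) C"]
    by auto
  then have "fun_dim (\<alpha> ` insert e H) \<le> card (insert (\<alpha> e) C)"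
    by (rule fun_vs.dim_le_card) (simp add: fin)
  also have "\<dots> \<le> card C + 1" using fin by (simp add: card_insert_if)
  finally show ?thesis using C(3) by (simp add: vrank_def)
qed

subsection \<open>Cocircuits and common zeros\<close>

text \<open>Each support \<open>{i\<in>E. \<alpha> i v \<noteq> 0}\<close> of a nonzero
  \<open>v\<close> contains a cocircuit, and each cocircuit contains such a support. So both
  families have the same lower bounds on size.\<close>

lemma cocircuits_bound_iff:
  fixes \<alpha> :: "nat \<Rightarrow> 'b \<Rightarrow> 'a"
  assumes fin: "finite E" and dual: "\<alpha> ` E \<subseteq> dual_space scale"
    and span: "fun_span (\<alpha> ` E) = dual_space scale"
  shows "(\<forall>C\<in>cocircuits E (vrank \<alpha>) (dim UNIV). d \<le> card C) \<longleftrightarrow>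
    (\<forall>v. v \<noteq> 0 \<longrightarrow> d \<le> card {i\<in>E. \<alpha> i v \<noteq> 0})"
proof (intro iffI allI ballI impI)
  fix v :: 'b assume "v \<noteq> 0"
    and bound: "\<forall>C\<in>cocircuits E (vrank \<alpha>) (dim UNIV). d \<le> card C"
  let ?H0 = "{i\<in>E. \<alpha> i v = 0}"
  \<comment> \<open>At full rank the forms indexed by \<open>?H0\<close> would span the dual space;
    but they all vanish at \<open>v\<close>, whereas some coordinate of \<open>v\<close> does
    not.\<close>
  have small: "vrank \<alpha> ?H0 < dim UNIV"
  proof (rule ccontr)
    assume "\<not> ?thesis"
    then have sp: "fun_span (\<alpha> ` ?H0) = dual_space scale"
      using fin dual by (intro spanning_if_vrank_ge_dim) auto
    have "fun_vs.subspace {f. f v = 0}"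
      by (auto simp: fun_vs.subspace_def)
    then have "fun_span (\<alpha> ` ?H0) \<subseteq> {f. f v = 0}"
      by (intro fun_vs.span_minimal) auto
    moreover obtain b where "coord b v \<noteq> 0"
      using ex_representation_nonzero[OF \<open>v \<noteq> 0\<close>] unfolding coord_def by blast
    ultimately show False using coord_dual sp by blast
  qed
  \<comment> \<open>The rank of \<open>?H0\<close> may be less than \<open>dim UNIV - 1\<close>, so
    \<open>?H0\<close> is enlarged to a maximal set of deficient rank, which turns out to be a
    hyperplane.\<close>
  define \<H> where "\<H> = {H. ?H0 \<subseteq> H \<and> H \<subseteq> E \<and> vrank \<alpha> H < dim UNIV}"
  have "finite \<H>" "?H0 \<in> \<H>" using fin small by (auto simp: \<H>_def)
  then obtain H where H: "H \<in> \<H>" and max: "\<forall>Y\<in>\<H>. H \<subseteq> Y \<longrightarrow> H = Y"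
    by (meson finite_has_maximal2)
  have H': "?H0 \<subseteq> H" "H \<subseteq> E" "vrank \<alpha> H < dim UNIV" using H by (auto simp: \<H>_def)
  have large: "dim UNIV \<le> vrank \<alpha> Y" if "H \<subset> Y" "Y \<subseteq> E" for Y
  proof (rule ccontr)
    assume "\<not> ?thesis"
    then have "Y \<in> \<H>" using that H'(1) by (auto simp: \<H>_def)
    then show False using max that(1) by blast
  qed
  then have "flat E (vrank \<alpha>) H"
    unfolding flat_def using H'(2,3) by (meson less_le_trans)
  moreover have "vrank \<alpha> H + 1 = dim UNIV"
  proof -
    \<comment> \<open>Since \<open>E\<close> has full rank, \<open>H\<close> misses some
      \<open>e\<close>. Adding \<open>e\<close> reaches full rank by maximality, but raises the rank
      by at most one.\<close>
    have "H \<noteq> E" using vrank_eq_dim_if_spanning[OF span] H'(3) by auto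
    then obtain e where "e \<in> E" "e \<notin> H" using H'(2) by blast
    then have "dim UNIV \<le> vrank \<alpha> (insert e H)" using H'(2) by (intro large) auto
    then show ?thesis
      using vrank_insert_le[of H \<alpha> e] H'(2,3) finite_subset[OF H'(2) fin] by linarith
  qed
  ultimately have "d \<le> card (E - H)" using bound by (auto simp: cocircuits_def)
  also have "\<dots> \<le> card {i\<in>E. \<alpha> i v \<noteq> 0}"
    using H'(1) fin by (intro card_mono) auto
  finally show "d \<le> card {i\<in>E. \<alpha> i v \<noteq> 0}" .
next
  fix C assume bound: "\<forall>v. v \<noteq> 0 \<longrightarrow> d \<le> card {i\<in>E. \<alpha> i v \<noteq> 0}"
    and "C \<in> cocircuits E (vrank \<alpha>) (dim UNIV)"
  then obtain H where H: "C = E - H" "H \<subseteq> E" "vrank \<alpha> H + 1 = dim UNIV"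
    by (auto simp: cocircuits_def flat_def)
  have finH: "finite H" using H(2) fin finite_subset by blast
  have dualH: "\<alpha> ` H \<subseteq> dual_space scale" using H(2) dual by blast
  \<comment> \<open>If 0 were the only common zero, every functional would vanish on the common
    kernel, so the forms indexed by \<open>H\<close> would span and have full rank.\<close>
  have "\<exists>v. v \<noteq> 0 \<and> (\<forall>j\<in>H. \<alpha> j v = 0)"
  proof (rule ccontr)
    assume no: "\<not> ?thesis"
    have "dual_space scale \<subseteq> fun_span (\<alpha> ` H)"
    proof
      fix f assume f: "f \<in> dual_space scale"
      show "f \<in> fun_span (\<alpha> ` H)"
      proof (rule in_fun_span_if_vanishes_on_common_kernel[OF finH _ f])
        fix v assume "\<forall>j\<in>H. \<alpha> j v = 0"
        then have "v = 0" using no by blast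
        then show "f v = 0" using f by (simp add: dual_spaceD)
      qed (use dualH in auto)
    qed
    moreover have "fun_span (\<alpha> ` H) \<subseteq> dual_space scale"
      using dualH by (rule fun_vs.span_minimal) (rule subspace_dual_space)
    ultimately have "vrank \<alpha> H = dim UNIV"
      by (intro vrank_eq_dim_if_spanning) blast
    then show False using H(3) by simp
  qed
  then obtain v where "v \<noteq> 0" "\<forall>j\<in>H. \<alpha> j v = 0" by blast
  then have "d \<le> card {i\<in>E. \<alpha> i v \<noteq> 0}" "{i\<in>E. \<alpha> i v \<noteq> 0} \<subseteq> C"
    using bound H(1) by auto
  then show "d \<le> card C"
    using card_mono[of C "{i\<in>E. \<alpha> i v \<noteq> 0}"] H(1) fin by auto
qed

end

subsection \<open>Homogeneous polynomials\<close>

lemma poly_mapping_sum_singles: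
  "(\<Sum>m\<in>Poly_Mapping.keys p. Poly_Mapping.single m (Poly_Mapping.lookup p m)) = p"
  by (rule poly_mapping_eqI)
    (simp add: lookup_sum lookup_single when_def in_keys_iff)

text \<open>Summing exponents over the fixed set \<open>B\<close> instead of the keys of each
  monomial makes the degree visibly additive.\<close>

lemma in_Sym_iff:
  assumes "finite B"
  shows "p \<in> Sym B d \<longleftrightarrow> (\<forall>m\<in>Poly_Mapping.keys p.
    Poly_Mapping.keys m \<subseteq> B \<and> (\<Sum>b\<in>B. Poly_Mapping.lookup m b) = d)"
proof -
  have "(\<Sum>b\<in>Poly_Mapping.keys m. Poly_Mapping.lookup m b) = (\<Sum>b\<in>B. Poly_Mapping.lookup m b)"
    if "Poly_Mapping.keys m \<subseteq> B" for m :: "'a \<Rightarrow>\<^sub>0 nat"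
    using that assms by (intro sum.mono_neutral_left) (auto simp: in_keys_iff)
  then show ?thesis by (auto simp: Sym_def)
qed

lemma keys_sym_form:
  assumes "finite B" "m \<in> Poly_Mapping.keys (sym_form B f)"
  shows "\<exists>b\<in>B. m = Poly_Mapping.single b 1"
proof -
  have "m \<in> (\<Union>b\<in>B. Poly_Mapping.keys (Poly_Mapping.single (Poly_Mapping.single b 1) (f b)))"
    using assms(2) unfolding sym_form_def by (rule subsetD[OF keys_sum])
  then show ?thesis by (auto split: if_splits)
qed

lemma sym_form_mult_in_Sym:
  assumes B: "finite B" and q: "q \<in> Sym B e"
  shows "sym_form B f * q \<in> Sym B (Suc e)"
  unfolding in_Sym_iff[OF B]
proof
  fix m assume "m \<in> Poly_Mapping.keys (sym_form B f * q)"
  then obtain x y where m: "m = x + y" "x \<in> Poly_Mapping.keys (sym_form B f)"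
    "y \<in> Poly_Mapping.keys q"
    using keys_mult by blast
  obtain b where b: "b \<in> B" "x = Poly_Mapping.single b 1"
    using keys_sym_form[OF B m(2)] by blast
  have y: "Poly_Mapping.keys y \<subseteq> B" "(\<Sum>b\<in>B. Poly_Mapping.lookup y b) = e"
    using q m(3) by (auto simp: in_Sym_iff[OF B])
  have "Poly_Mapping.keys m \<subseteq> B"
    using keys_add[of x y] b y by (auto simp: m(1))
  moreover have "(\<Sum>b\<in>B. Poly_Mapping.lookup m b) = Suc e"
    using b y B by (simp add: m(1) lookup_add sum.distrib lookup_single when_def)
  ultimately show "Poly_Mapping.keys m \<subseteq> B \<and> (\<Sum>b\<in>B. Poly_Mapping.lookup m b) = Suc e" ..
qed

lemma sym_form_add: "sym_form B (f + g) = sym_form B f + sym_form B g"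
  by (simp add: sym_form_def single_add sum.distrib)

lemma sym_form_scale: "sym_form B (\<lambda>x. c * f x) = Poly_Mapping.single 0 c * sym_form B f"
  by (simp add: sym_form_def sum_distrib_left mult_single)

lemma sym_form_zero: "sym_form B 0 = 0"
  by (simp add: sym_form_def)

text \<open>The product \<open>sym_form B f * q\<close> is linear in \<open>f\<close>, so membership
  has to be checked only on the generators \<open>\<alpha> j\<close>.\<close>

lemma sym_form_mult_in_span:
  assumes f: "f \<in> fun_span (\<alpha> ` T)"
    and gens: "\<And>j. j \<in> T \<Longrightarrow> sym_form B (\<alpha> j) * q \<in> sym_span G"
  shows "sym_form B f * q \<in> sym_span G"
  using f
proof (induction rule: fun_vs.span_induct)
  case base
  show ?case
  proof (rule fun_vs.subspaceI; clarsimp)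
    show "sym_form B 0 * q \<in> sym_span G"
      by (simp add: sym_form_zero sym_vs.span_zero)
  next
    fix x y assume "sym_form B x * q \<in> sym_span G" "sym_form B y * q \<in> sym_span G"
    then show "sym_form B (x + y) * q \<in> sym_span G"
      by (simp add: sym_form_add distrib_right sym_vs.span_add)
  next
    fix c x assume "sym_form B x * q \<in> sym_span G"
    then have "Poly_Mapping.single 0 c * (sym_form B x * q) \<in> sym_span G"
      by (rule sym_vs.span_scale)
    then show "sym_form B (\<lambda>v. c * x v) * q \<in> sym_span G"
      by (simp add: sym_form_scale mult.assoc)
  qed
qed (auto intro: gens)

lemma mult_in_sym_span:
  assumes p: "p \<in> sym_span G" and gens: "\<And>g. g \<in> G \<Longrightarrow> a * g \<in> sym_span G'"
  shows "a * p \<in> sym_span G'"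
  using p
proof (induction rule: sym_vs.span_induct)
  case base
  show ?case
  proof (rule sym_vs.subspaceI; clarsimp)
    show "0 \<in> sym_span G'" by (rule sym_vs.span_zero)
  next
    fix x y assume "a * x \<in> sym_span G'" "a * y \<in> sym_span G'"
    then show "a * (x + y) \<in> sym_span G'"
      by (simp add: distrib_left sym_vs.span_add)
  next
    fix c x assume "a * x \<in> sym_span G'"
    then have "Poly_Mapping.single 0 c * (a * x) \<in> sym_span G'"
      by (rule sym_vs.span_scale)
    then show "a * (Poly_Mapping.single 0 c * x) \<in> sym_span G'"
      by (simp add: mult.left_commute)
  qed
qed (auto intro: gens)

lemma Sym_zero_subset_span: "(1::('v, 'k::field) sympoly) \<in> G \<Longrightarrow> Sym B 0 \<subseteq> sym_span G"
proof
  fix p :: "('v, 'k) sympoly" assume G: "1 \<in> G" and p: "p \<in> Sym B 0"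
  have "m = 0" if "m \<in> Poly_Mapping.keys p" for m
  proof (rule poly_mapping_eqI)
    fix b 
    have "(\<Sum>b\<in>Poly_Mapping.keys m. Poly_Mapping.lookup m b) = 0"
      using p that by (auto simp: Sym_def)
    then show "Poly_Mapping.lookup m b = Poly_Mapping.lookup 0 b"
      by (auto simp: in_keys_iff)
  qed
  then have "p = Poly_Mapping.single 0 (Poly_Mapping.lookup p 0)"
    by (intro poly_mapping_eqI) (metis in_keys_iff lookup_single_eq lookup_single_not_eq)
  then have "p = Poly_Mapping.single 0 (Poly_Mapping.lookup p 0) * 1" by simp
  then show "p \<in> sym_span G"
    using G by (metis sym_vs.span_base sym_vs.span_scale)
qed

subsection \<open>Products of forms span under the distance condition\<close>

context finite_dimensional_vector_space
begin

lemma sym_form_coord: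
  assumes "b \<in> Basis"
  shows "sym_form Basis (coord b) = Poly_Mapping.single (Poly_Mapping.single b 1) 1"
proof -
  have "sym_form Basis (coord b) =
      (\<Sum>c\<in>Basis. if c = b then Poly_Mapping.single (Poly_Mapping.single b 1) 1 else 0)"
    unfolding sym_form_def
    by (intro sum.cong) (auto simp: coord_def representation_Basis_self)
  then show ?thesis using assms finite_Basis by simp
qed

text \<open>Every monomial of degree \<open>Suc e\<close> is a variable times a monomial of degree
  \<open>e\<close>, and that variable is a linear combination of the forms indexed by
  \<open>T\<close>.\<close>

lemma Sym_Suc_subset_span:
  fixes G :: "('b, 'a) sympoly set"
  assumes span: "dual_space scale \<subseteq> fun_span (\<alpha> ` T)"
    and gens: "\<And>j q. j \<in> T \<Longrightarrow> q \<in> Sym Basis e \<Longrightarrow> sym_form Basis (\<alpha> j) * q \<in> sym_span G"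
  shows "Sym Basis (Suc e) \<subseteq> sym_span G"
proof
  fix p :: "('b, 'a) sympoly" assume p: "p \<in> Sym Basis (Suc e)"
  have "Poly_Mapping.single m c \<in> sym_span G" if m: "m \<in> Poly_Mapping.keys p" for m c
  proof -
    have m': "Poly_Mapping.keys m \<subseteq> Basis" "(\<Sum>b\<in>Basis. Poly_Mapping.lookup m b) = Suc e"
      using p m by (auto simp: in_Sym_iff[OF finite_Basis])
    obtain b where b: "b \<in> Basis" "Poly_Mapping.lookup m b \<noteq> 0"
      using m'(2) by (metis nat.distinct(1) sum.neutral)
    \<comment> \<open>The subtraction of exponents is truncated, but exact here because
      \<open>b\<close> occurs in \<open>m\<close>.\<close>
    define m1 where "m1 = m - Poly_Mapping.single b 1"
    have m1: "m = Poly_Mapping.single b 1 + m1"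
      using b(2) by (intro poly_mapping_eqI)
        (auto simp: m1_def lookup_add lookup_minus lookup_single when_def)
    have "Poly_Mapping.keys m1 \<subseteq> Poly_Mapping.keys m"
      by (auto simp: m1_def in_keys_iff lookup_minus)
    moreover have "(\<Sum>b\<in>Basis. Poly_Mapping.lookup m1 b) = e"
      using m'(2) b(1) finite_Basis
      by (simp add: m1 lookup_add sum.distrib lookup_single when_def)
    ultimately have "Poly_Mapping.single m1 c \<in> Sym Basis e"
      using m'(1) by (auto simp: in_Sym_iff[OF finite_Basis])
    then have "sym_form Basis (coord b) * Poly_Mapping.single m1 c \<in> sym_span G"
      using span coord_dual by (blast intro: sym_form_mult_in_span[of _ \<alpha> T] gens)
    then show ?thesis unfolding sym_form_coord[OF b(1)] mult_single m1[symmetric] by simp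
  qed
  then have "(\<Sum>m\<in>Poly_Mapping.keys p. Poly_Mapping.single m (Poly_Mapping.lookup p m)) \<in> sym_span G"
    by (intro sym_vs.span_sum)
  then show "p \<in> sym_span G" by (simp add: poly_mapping_sum_singles)
qed

text \<open>The second set is the degree \<open>d\<close> part of the ideal generated by the forms indexed by \<open>T\<close>, up
  to linear span; it is empty for \<open>d = 0\<close>.\<close>

definition span_gens :: "('i \<Rightarrow> 'b \<Rightarrow> 'a) \<Rightarrow> 'i set \<Rightarrow> 'i set \<Rightarrow> nat \<Rightarrow> ('b, 'a) sympoly set" where
  "span_gens \<alpha> S T d = {\<Prod>i\<in>R. sym_form Basis (\<alpha> i) | R. R \<subseteq> S} \<union>
     {sym_form Basis (\<alpha> j) * q | j q. j \<in> T \<and> (\<exists>e. d = Suc e \<and> q \<in> Sym Basis e)}"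

text \<open>The case \<open>T = {}\<close> is the distance condition for all of \<open>V\<close>.
  Both \<open>T\<close> and \<open>d\<close> vary in the induction: contraction enlarges
  \<open>T\<close>, deletion lowers \<open>d\<close>.\<close>

lemma Sym_subset_span_gens:
  assumes "finite S" "finite T" "\<forall>j\<in>S \<union> T. \<alpha> j \<in> dual_space scale"
    and "\<forall>v. v \<noteq> 0 \<and> (\<forall>j\<in>T. \<alpha> j v = 0) \<longrightarrow> d \<le> card {i\<in>S. \<alpha> i v \<noteq> 0}"
  shows "Sym Basis d \<subseteq> sym_span (span_gens \<alpha> S T d)"
  using assms
proof (induction S arbitrary: T d rule: finite_induct)
  case empty
  show ?case
  proof (cases d)
    case 0
    then show ?thesis by (auto intro!: Sym_zero_subset_span simp: span_gens_def)
  next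
    case (Suc e)
    have "dual_space scale \<subseteq> fun_span (\<alpha> ` T)"
    proof
      fix f assume f: "f \<in> dual_space scale"
      show "f \<in> fun_span (\<alpha> ` T)"
      proof (rule in_fun_span_if_vanishes_on_common_kernel[OF _ _ f])
        fix v assume "\<forall>j\<in>T. \<alpha> j v = 0"
        \<comment> \<open>With no forms left to count, the hypothesis for \<open>Suc e\<close>
          excludes every nonzero common zero of the forms in \<open>T\<close>.\<close>
        then have "v = 0" using empty.prems Suc by auto
        then show "f v = 0" using f by (simp add: dual_spaceD)
      qed (use empty.prems in auto)
    qed
    then show ?thesis
      unfolding Suc by (rule Sym_Suc_subset_span) (auto intro!: sym_vs.span_base simp: span_gens_def)
  qed
next
  case (insert a S)
  show ?case
  proof (cases d)
    case 0
    have "1 \<in> span_gens \<alpha> (insert a S) T d"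
      unfolding span_gens_def by (auto intro!: exI[of _ "{}"])
    then show ?thesis using 0 by (simp add: Sym_zero_subset_span)
  next
    case (Suc e)
    let ?G = "span_gens \<alpha> (insert a S) T (Suc e)"
    have count: "card {i\<in>insert a S. \<alpha> i v \<noteq> 0} =
        card {i\<in>S. \<alpha> i v \<noteq> 0} + (if \<alpha> a v = 0 then 0 else 1)" for v
    proof -
      have "{i\<in>insert a S. \<alpha> i v \<noteq> 0} =
          (if \<alpha> a v = 0 then {i\<in>S. \<alpha> i v \<noteq> 0} else insert a {i\<in>S. \<alpha> i v \<noteq> 0})"
        by auto
      then show ?thesis using insert.hyps by auto
    qed
    \<comment> \<open>Deletion: dropping \<open>a\<close> lowers each count by at most one, which
      the smaller degree \<open>e\<close> compensates.\<close>
    have del: "Sym Basis e \<subseteq> sym_span (span_gens \<alpha> S T e)"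
    proof (rule insert.IH)
      show "\<forall>v. v \<noteq> 0 \<and> (\<forall>j\<in>T. \<alpha> j v = 0) \<longrightarrow> e \<le> card {i\<in>S. \<alpha> i v \<noteq> 0}"
        using insert.prems(3) unfolding Suc count by (auto split: if_splits)
    qed (use insert.prems in auto)
    \<comment> \<open>Contraction: only vectors with \<open>\<alpha> a v = 0\<close> remain, and for
      these dropping \<open>a\<close> does not change the count, so the degree stays.\<close>
    have contr: "Sym Basis (Suc e) \<subseteq> sym_span (span_gens \<alpha> S (insert a T) (Suc e))"
    proof (rule insert.IH)
      show "\<forall>v. v \<noteq> 0 \<and> (\<forall>j\<in>insert a T. \<alpha> j v = 0) \<longrightarrow> Suc e \<le> card {i\<in>S. \<alpha> i v \<noteq> 0}"
        using insert.prems(3) unfolding Suc count by (auto split: if_splits)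
    qed (use insert.prems in auto)
    \<comment> \<open>Multiplication by the form of \<open>a\<close> adds the index \<open>a\<close>
      to a product over \<open>R \<subseteq> S\<close> and keeps a multiple of a form from
      \<open>T\<close> such a multiple, with the cofactor one degree higher.\<close>
    have a: "sym_form Basis (\<alpha> a) * q \<in> sym_span ?G" if "q \<in> Sym Basis e" for q
    proof (rule mult_in_sym_span)
      show "q \<in> sym_span (span_gens \<alpha> S T e)" using that del by blast
      fix g assume "g \<in> span_gens \<alpha> S T e"
      then consider R where "R \<subseteq> S" "g = (\<Prod>i\<in>R. sym_form Basis (\<alpha> i))"
        | j q e' where "j \<in> T" "e = Suc e'" "q \<in> Sym Basis e'" "g = sym_form Basis (\<alpha> j) * q"
        by (auto simp: span_gens_def)
      then have "sym_form Basis (\<alpha> a) * g \<in> ?G"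
      proof cases
        case 1
        have "finite R" "a \<notin> R" using 1(1) insert.hyps finite_subset by auto
        then have "sym_form Basis (\<alpha> a) * g = (\<Prod>i\<in>insert a R. sym_form Basis (\<alpha> i))"
          using 1(2) by simp
        then show ?thesis using 1(1) unfolding span_gens_def by blast
      next
        case 2
        have "sym_form Basis (\<alpha> a) * g = sym_form Basis (\<alpha> j) * (sym_form Basis (\<alpha> a) * q)"
          using 2(4) by (simp add: mult.left_commute)
        then show ?thesis
          using 2 sym_form_mult_in_Sym[OF finite_Basis 2(3)] unfolding span_gens_def by blast
      qed
      then show "sym_form Basis (\<alpha> a) * g \<in> sym_span ?G" by (rule sym_vs.span_base)
    qed
    have "span_gens \<alpha> S (insert a T) (Suc e) \<subseteq> sym_span ?G"
    proof
      \<comment> \<open>The only generators not visibly in \<open>?G\<close> are the multiples of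
        the form of \<open>a\<close>; their cofactors have degree \<open>e\<close>, so the previous
        step applies.\<close>
      fix g assume "g \<in> span_gens \<alpha> S (insert a T) (Suc e)"
      then have "g \<in> ?G \<or> (\<exists>q\<in>Sym Basis e. g = sym_form Basis (\<alpha> a) * q)"
        unfolding span_gens_def by blast
      then show "g \<in> sym_span ?G" using a sym_vs.span_base by blast
    qed
    then have "sym_span (span_gens \<alpha> S (insert a T) (Suc e)) \<subseteq> sym_span ?G"
      by (rule sym_vs.span_minimal) (rule sym_vs.subspace_span)
    then show ?thesis using contr Suc by blast
  qed
qed

end

subsection \<open>Restriction to a line\<close>

text \<open>The algebra homomorphism \<open>x\<^sub>b \<mapsto> x b \<cdot> t\<close>, which restricts polynomial functions to the line
  through the point with coordinates \<open>x\<close>. Variables outside \<open>B\<close> are sent to 1.\<close>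

definition line_subst :: "'v set \<Rightarrow> ('v \<Rightarrow> 'k) \<Rightarrow> ('v, 'k::field) sympoly \<Rightarrow> 'k poly" where
  "line_subst B x p = (\<Sum>m\<in>Poly_Mapping.keys p.
     smult (Poly_Mapping.lookup p m) (\<Prod>b\<in>B. monom (x b) 1 ^ Poly_Mapping.lookup m b))"

lemma line_subst_zero [simp]: "line_subst B x 0 = 0"
  by (simp add: line_subst_def)

lemma line_subst_add: "line_subst B x (p + q) = line_subst B x p + line_subst B x q"
  unfolding line_subst_def by (rule setsum_keys_plus_distrib) (simp_all add: smult_add_left)

lemma line_subst_sum: "line_subst B x (sum f A) = (\<Sum>a\<in>A. line_subst B x (f a))"
  by (induction A rule: infinite_finite_induct) (simp_all add: line_subst_add)

lemma line_subst_single: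
  "line_subst B x (Poly_Mapping.single m c) =
    smult c (\<Prod>b\<in>B. monom (x b) 1 ^ Poly_Mapping.lookup m b)"
  by (simp add: line_subst_def)

text \<open>Expanding both factors into monomials reduces the claim to single monomials, where
  exponents add.\<close>

lemma line_subst_mult: "line_subst B x (p * q) = line_subst B x p * line_subst B x q"
proof -
  let ?s = "\<lambda>p m. Poly_Mapping.single m (Poly_Mapping.lookup p m)"
  have single: "line_subst B x (?s p m * ?s q m') = line_subst B x (?s p m) * line_subst B x (?s q m')"
    for m m'
    by (simp add: mult_single line_subst_single lookup_add power_add prod.distrib mult.commute)
  have "line_subst B x (p * q) =
      line_subst B x ((\<Sum>m\<in>Poly_Mapping.keys p. ?s p m) * (\<Sum>m\<in>Poly_Mapping.keys q. ?s q m))"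
    by (simp add: poly_mapping_sum_singles)
  also have "\<dots> = line_subst B x (\<Sum>m\<in>Poly_Mapping.keys p. ?s p m) *
      line_subst B x (\<Sum>m\<in>Poly_Mapping.keys q. ?s q m)"
    by (simp only: sum_product line_subst_sum single)
  finally show ?thesis by (simp add: poly_mapping_sum_singles)
qed

lemma line_subst_one: "line_subst B x 1 = 1"
  using line_subst_single[of B x 0 1] by simp

lemma line_subst_prod: "line_subst B x (prod f A) = (\<Prod>a\<in>A. line_subst B x (f a))"
  by (induction A rule: infinite_finite_induct) (simp_all add: line_subst_mult line_subst_one)

lemma line_subst_variable:
  assumes "finite B" "b \<in> B"
  shows "line_subst B x (Poly_Mapping.single (Poly_Mapping.single b k) c) = monom (c * x b ^ k) k"
proof -
  have "(\<Prod>i\<in>B. monom (x i) 1 ^ Poly_Mapping.lookup (Poly_Mapping.single b k) i) =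
      (\<Prod>i\<in>B. if i = b then monom (x b) 1 ^ k else 1)"
    by (intro prod.cong) (auto simp: lookup_single when_def)
  then show ?thesis
    using assms by (simp add: line_subst_single monom_power smult_monom)
qed

lemma line_subst_sym_form:
  assumes "finite B"
  shows "line_subst B x (sym_form B f) = monom (\<Sum>b\<in>B. f b * x b) 1"
proof -
  have "line_subst B x (sym_form B f) = (\<Sum>b\<in>B. monom (f b * x b) 1)"
    unfolding sym_form_def line_subst_sum
    using line_subst_variable[OF assms, of _ x 1] by (intro sum.cong) auto
  then show ?thesis by (simp add: monom_sum)
qed

lemma prod_monom_one: "(\<Prod>i\<in>S. monom (c i) 1) = monom (\<Prod>i\<in>S. c i) (card S)"
  by (induction S rule: infinite_finite_induct) (simp_all add: mult_monom)

context finite_dimensional_vector_space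
begin

text \<open>Elements of \<open>P_space\<close> need not be homogeneous, so they are restricted to
  the line through \<open>v\<close> rather than evaluated at \<open>v\<close>: the coefficient of
  \<open>t^d\<close> is the value at \<open>v\<close> of the degree \<open>d\<close> part.\<close>

lemma card_nonzero_ge_if_Sym_subset:
  fixes \<alpha> :: "nat \<Rightarrow> 'b \<Rightarrow> 'a"
  assumes fin: "finite E" and dual: "\<alpha> ` E \<subseteq> dual_space scale"
    and sub: "Sym Basis d \<subseteq> P_space Basis E \<alpha>" and "v \<noteq> 0"
  shows "d \<le> card {i\<in>E. \<alpha> i v \<noteq> 0}"
proof (rule ccontr)
  assume small: "\<not> ?thesis"
  define L where "L = line_subst Basis (representation Basis v)"
  have vanish: "coeff (L p) d = 0" if "p \<in> P_space Basis E \<alpha>" for p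
    using that unfolding P_space_def
  proof (induction rule: sym_vs.span_induct)
    case base
    have "L (Poly_Mapping.single 0 c * p) = smult c (L p)" for c p
      by (simp add: L_def line_subst_mult line_subst_single)
    then show ?case
      by (auto intro!: sym_vs.subspaceI simp: L_def line_subst_add)
  next
    case (step p)
    then obtain S where S: "S \<subseteq> E" "p = (\<Prod>i\<in>S. sym_form Basis (\<alpha> i))" by blast
    have "L p = (\<Prod>i\<in>S. monom (\<alpha> i v) 1)"
      unfolding S(2) L_def line_subst_prod
    proof (rule prod.cong)
      fix i assume "i \<in> S"
      then have "\<alpha> i v = (\<Sum>b\<in>Basis. \<alpha> i b * representation Basis v b)"
        using S(1) dual dual_space_expand[of "\<alpha> i" v] by (auto simp: mult.commute)
      then show "line_subst Basis (representation Basis v) (sym_form Basis (\<alpha> i)) =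
          monom (\<alpha> i v) 1"
        by (simp add: line_subst_sym_form[OF finite_Basis])
    qed simp
    then have L: "L p = monom (\<Prod>i\<in>S. \<alpha> i v) (card S)" by (simp only: prod_monom_one)
    \<comment> \<open>Only products of exactly \<open>d\<close> forms can contribute to
      \<open>t^d\<close>, and they have a factor vanishing at \<open>v\<close> since fewer than
      \<open>d\<close> forms are nonzero there.\<close>
    have "(\<Prod>i\<in>S. \<alpha> i v) = 0" if "card S = d"
    proof (rule ccontr)
      have "finite S" using S(1) fin finite_subset by blast
      moreover assume "(\<Prod>i\<in>S. \<alpha> i v) \<noteq> 0"
      ultimately have "S \<subseteq> {i\<in>E. \<alpha> i v \<noteq> 0}" using S(1) by (auto simp: prod_zero_iff)
      then have "card S \<le> card {i\<in>E. \<alpha> i v \<noteq> 0}" using fin by (intro card_mono) auto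
      then show False using small that by simp
    qed
    then show ?case by (simp add: L)
  qed
  obtain b where b: "b \<in> Basis" "representation Basis v b \<noteq> 0"
    using ex_representation_nonzero[OF \<open>v \<noteq> 0\<close>] by blast
  \<comment> \<open>The power \<open>x_b^d\<close> restricts to a nonzero multiple of
    \<open>t^d\<close>, because the coordinate of \<open>v\<close> at \<open>b\<close> is
    nonzero.\<close>
  let ?p = "Poly_Mapping.single (Poly_Mapping.single b d) (1::'a)"
  have "?p \<in> Sym Basis d"
    using b(1) finite_Basis by (auto simp: in_Sym_iff lookup_single when_def)
  then have "coeff (L ?p) d = 0" using sub vanish by blast
  then show False
    using b finite_Basis by (simp add: L_def line_subst_variable)
qed

end

theorem theorem5p1:
  fixes scale :: "'k::field \<Rightarrow> 'v::ab_group_add \<Rightarrow> 'v"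
    and B :: "'v set"
    and \<alpha> :: "nat \<Rightarrow> 'v \<Rightarrow> 'k"
    and l n d :: nat
  assumes "finite_dimensional_vector_space scale B"
    and "vector_space.dim scale (UNIV :: 'v set) = l"
    and "\<forall>i\<in>{1..n}. \<alpha> i \<in> dual_space scale"
    and "fun_span (\<alpha> ` {1..n}) = dual_space scale"
  shows "(Sym B d :: ('v, 'k) sympoly set) \<subseteq> P_space B {1..n} \<alpha> \<longleftrightarrow>
    enat d \<le> (INF C\<in>cocircuits {1..n} (vrank \<alpha>) l. enat (card C))"
proof -
  interpret finite_dimensional_vector_space scale B by fact
  have dual: "\<alpha> ` {1..n} \<subseteq> dual_space scale" using assms(3) by blast
  \<comment> \<open>For \<open>T = {}\<close> the ideal part of the generators is empty, which
    leaves the products defining \<open>P_space\<close> for every \<open>d\<close>.\<close>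
  have P: "sym_span (span_gens \<alpha> {1..n} {} d) = P_space B {1..n} \<alpha>"
    by (simp add: span_gens_def P_space_def)
  have "Sym B d \<subseteq> P_space B {1..n} \<alpha> \<longleftrightarrow> (\<forall>v. v \<noteq> 0 \<longrightarrow> d \<le> card {i\<in>{1..n}. \<alpha> i v \<noteq> 0})"
    using card_nonzero_ge_if_Sym_subset[OF _ dual, of d]
      Sym_subset_span_gens[of "{1..n}" "{}" \<alpha> d] assms(3) unfolding P by auto
  also have "\<dots> \<longleftrightarrow> (\<forall>C\<in>cocircuits {1..n} (vrank \<alpha>) l. d \<le> card C)"
    using cocircuits_bound_iff[OF _ dual assms(4), of d] assms(2) by simp
  \<comment> \<open>The infimum is taken in \<open>enat\<close>, so without cocircuits, as for
    \<open>l = 0\<close>, it is infinite and the bound holds for all \<open>d\<close>.\<close>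
  finally show ?thesis by (simp add: le_INF_iff)
qed

end
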